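(* Let $\mu:\mathbb{N}\to\{-1,0,1\}$ be the Möbius function. Suppose that for every integer $k\ge 2$ and every Toeplitz sequence $\mathbf{b}=(b_n)_{n\in\mathbb{Z}}\in\{1,\ldots,k\}^{\mathbb{Z}}$ with zero entropy, $h(\mathbf{b})=0$, one has $$\lim_{N\to\infty}\frac1N\sum_{n=1}^{N}\mu(n)b_n=0.$$ Then the Sarnak conjecture holds, that is: for every topological dynamical system $(X,T)$ with zero topological entropy, every $f\in C(X)$ and every $x\in X$, $$\lim_{N\to\infty}\frac1N\sum_{n=1}^{N}\mu(n)f(T^nx)=0.$$
   Context: The Möbius function is given by $\mu(1)=1$, $\mu(n)=(-1)^j$ if $n$ is a product of $j$ distinct primes, and $\mu(n)=0$ otherwise. Here $\mathbb{N}=\{1,2,3,\ldots\}$. A topological dynamical system $(X,T)$ is a compact metric space $X$ together with a homeomorphism $T:X\to X$; $C(X)$ is the space of continuous (complex-valued) functions on $X$. Let $\Sigma_k=\{1,\ldots,k\}^{\mathbb{Z}}$ carry the product topology (of the discrete topology on $\{1,\ldots,k\}$), and let $\sigma:\Sigma_k\to\Sigma_k$ be the shift, $(\sigma\mathbf{x})_n=x_{n+1}$. For $\omega\in\Sigma_k$, $X_\omega$ denotes the closure of the orbit $\{\sigma^n\omega:n\in\mathbb{Z}\}$. The entropy of $\omega$ is $h(\omega)=h(X_\omega,\sigma)=\lim_{n\to\infty}\frac{\log\# B_n(X_\omega)}{n}$, where $B_n(X_\omega)$ is the set of all words of length $n$ occurring in elements of $X_\omega$ and $\#$ denotes cardinality.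 A sequence $\omega\in\Sigma_k$ is a Toeplitz sequence if it is a regularly recurrent point of $(\Sigma_k,\sigma)$: for every open neighborhood $U$ of $\omega$ there is a positive integer $l$ such that $\sigma^{m}\omega\in U$ for all $m\in l\mathbb{Z}$. *)

theory Defs
  imports "HOL-Analysis.Analysis" "HOL-Computational_Algebra.Computational_Algebra"
begin

subsection \<open>The Moebius function\<close>

definition moebius_mu :: "nat \<Rightarrow> int" where
  "moebius_mu n = (if squarefree n then (-1) ^ card (prime_factors n) else 0)"

lemma moebius_mu_prod_primes:
  assumes "finite P" and "\<And>p. p \<in> P \<Longrightarrow> prime p"
  shows "moebius_mu (\<Prod>P) = (-1) ^ card P"
proof -
  have "squarefree (\<Prod>P)"
    using assms(2) by (intro squarefree_prod_coprime) (auto intro: squarefree_prime primes_coprime)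
  moreover have "prime_factors (\<Prod>P) = P"
  proof -
    have "0 \<notin> P" using assms(2) by force
    then have "prime_factors (\<Prod>P) = (\<Union>p\<in>P. prime_factors p)"
      using prime_factors_prod[of P "\<lambda>p. p"] assms(1) by auto
    also have "\<dots> = P" using assms(2) by (auto simp: prime_prime_factors)
    finally show ?thesis .
  qed
  ultimately show ?thesis by (simp add: moebius_mu_def)
qed

lemma moebius_mu_eq_0:
  assumes "\<And>P. finite P \<Longrightarrow> (\<And>p. p \<in> P \<Longrightarrow> prime p) \<Longrightarrow> n \<noteq> \<Prod>P"
  shows "moebius_mu n = 0"
proof (rule ccontr)
  assume "moebius_mu n \<noteq> 0"
  then have sf: "squarefree n" by (auto simp: moebius_mu_def split: if_splits)
  then have n0: "n \<noteq> 0" by (auto intro: ccontr)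
  have "n = (\<Prod>p\<in>prime_factors n. p ^ multiplicity p n)"
    using n0 by (simp add: prime_factorization_nat)
  also have "\<dots> = \<Prod>(prime_factors n)"
    using sf n0 by (intro prod.cong refl) (auto simp: squarefree_factorial_semiring')
  finally show False using assms[of "prime_factors n"] by auto
qed

subsection \<open>Topological dynamical systems and topological entropy\<close>

definition top_dyn_system :: "'a::metric_space set \<Rightarrow> ('a \<Rightarrow> 'a) \<Rightarrow> bool" where
  "top_dyn_system X T \<longleftrightarrow> compact X \<and> (\<exists>S. homeomorphism X X T S)"

text \<open>Entropy is defined following Bowen and Dinaburg. A set is \<open>(n, \<epsilon>)\<close>-spanning if every
  point of \<open>X\<close> stays \<open>\<epsilon>\<close>-close to one of its points during the first \<open>n\<close> steps.\<close>

definition spanning_set ::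
    "'a::metric_space set \<Rightarrow> ('a \<Rightarrow> 'a) \<Rightarrow> nat \<Rightarrow> real \<Rightarrow> 'a set \<Rightarrow> bool" where
  "spanning_set X T n \<epsilon> F \<longleftrightarrow>
     finite F \<and> F \<subseteq> X \<and> (\<forall>x\<in>X. \<exists>y\<in>F. \<forall>i<n. dist ((T ^^ i) x) ((T ^^ i) y) < \<epsilon>)"

definition spanning_number ::
    "'a::metric_space set \<Rightarrow> ('a \<Rightarrow> 'a) \<Rightarrow> nat \<Rightarrow> real \<Rightarrow> nat" where
  "spanning_number X T n \<epsilon> = (LEAST c. \<exists>F. spanning_set X T n \<epsilon> F \<and> card F = c)"

text \<open>The growth rate is antitone in \<open>\<epsilon>\<close>, so the supremum is the limit as \<open>\<epsilon>\<close> tends to 0.\<close>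

definition topological_entropy :: "'a::metric_space set \<Rightarrow> ('a \<Rightarrow> 'a) \<Rightarrow> ereal" where
  "topological_entropy X T =
     (SUP \<epsilon>\<in>{0<..}. limsup (\<lambda>n. ereal (ln (real (spanning_number X T n \<epsilon>)) / real n)))"

subsection \<open>Symbolic dynamics\<close>

definition full_shift :: "nat \<Rightarrow> (int \<Rightarrow> nat) topology" where
  "full_shift k = product_topology (\<lambda>_. discrete_topology {1..k}) UNIV"

definition shift :: "(int \<Rightarrow> nat) \<Rightarrow> (int \<Rightarrow> nat)" where
  "shift x = (\<lambda>n. x (n + 1))"

definition int_iterate :: "('a \<Rightarrow> 'a) \<Rightarrow> int \<Rightarrow> 'a \<Rightarrow> 'a" where
  "int_iterate T m = (if 0 \<le> m then T ^^ nat m else inv T ^^ nat (- m))"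

lemma int_iterate_shift: "int_iterate shift m x = (\<lambda>n. x (n + m))"
proof -
  have inv: "inv shift = (\<lambda>x n. x (n - 1))"
    by (rule inv_unique_comp) (auto simp: shift_def fun_eq_iff)
  have "(shift ^^ j) x = (\<lambda>n. x (n + int j))" for j
    by (induction j) (auto simp: shift_def fun_eq_iff algebra_simps)
  moreover have "(inv shift ^^ j) x = (\<lambda>n. x (n - int j))" for j
    by (induction j) (auto simp: inv fun_eq_iff algebra_simps)
  ultimately show ?thesis by (simp add: int_iterate_def)
qed

definition orbit_closure :: "nat \<Rightarrow> (int \<Rightarrow> nat) \<Rightarrow> (int \<Rightarrow> nat) set" where
  "orbit_closure k \<omega> = full_shift k closure_of {int_iterate shift m \<omega> | m. True}"

definition words :: "nat \<Rightarrow> (int \<Rightarrow> nat) set \<Rightarrow> nat list set" where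
  "words n X = {map (\<lambda>j. x (i + int j)) [0..<n] | x i. x \<in> X}"

definition seq_entropy :: "nat \<Rightarrow> (int \<Rightarrow> nat) \<Rightarrow> real" where
  "seq_entropy k \<omega> = lim (\<lambda>n. ln (real (card (words n (orbit_closure k \<omega>)))) / real n)"

definition toeplitz :: "nat \<Rightarrow> (int \<Rightarrow> nat) \<Rightarrow> bool" where
  "toeplitz k \<omega> \<longleftrightarrow> \<omega> \<in> topspace (full_shift k) \<and>
     (\<forall>U. openin (full_shift k) U \<and> \<omega> \<in> U \<longrightarrow>
        (\<exists>l::int. l > 0 \<and> (\<forall>m. l dvd m \<longrightarrow> int_iterate shift m \<omega> \<in> U)))"

end

theory Submission
  imports Defs
begin

text \<open>
  The idea is to imitate a zero-entropy orbit, along any prescribed sequence of times, by a zero-entropy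
  Toeplitz sequence (\<open>toeplitz_approximation\<close>). If an observable of the orbit correlated with the Moebius
  function at infinitely many times, a Toeplitz sequence built for these times would correlate as well. It
  suffices to treat a real observable \<open>g\<close>, and an affine change of scale costs nothing, since the constant
  sequence is itself Toeplitz of zero entropy.

  Two obstacles have to be overcome. Quantising \<open>g\<close> along an orbit may create entropy, because nearby points
  can receive different codes. Instead of the orbit itself one therefore quantises a pseudo-orbit. It is put
  together from finitely many blocks, chosen through spanning sets, of lengths \<open>l 0 | l 1 | \<dots>\<close> at all levels
  simultaneously. With errors summable over the levels it stays uniformly close to the true orbit
  (\<open>pseudo_orbit_shadows\<close>), and its aligned blocks of length \<open>l i\<close> are indexed by a set of at most
  \<open>exp (\<eta> i * l i)\<close> points with \<open>\<eta> i\<close> tending to 0 (\<open>pseudo_orbit_block\<close>).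

  The second obstacle is regular recurrence. Stage \<open>j\<close> writes the pseudo-orbit into the window \<open>[- N j, N j)\<close>
  and repeats it with a period \<open>p j\<close> that is much larger than \<open>N j\<close>, and earlier stages have priority. Every position then has
  a period (\<open>merge_periodic\<close>). In \<open>[0, N j)\<close> all but a small proportion of the positions carry the pseudo-orbit
  (\<open>card_overridden_le\<close>), and \<open>N j\<close> is chosen within a factor 2 of a time at which the correlation is
  large. If moreover \<open>p j\<close> divides \<open>l (j + 1)\<close>, the earlier stages disturb all blocks of length
  \<open>l (j + 1)\<close> in the same way. So merging keeps the number of blocks small at every length (\<open>merge_block\<close>), and
  this bounds the entropy by \<open>seq_entropy_eq_0I\<close>.
\<close>

section \<open>Entropy and regular recurrence of symbolic sequences\<close>

lemma topspace_full_shift: "topspace (full_shift k) = {x. \<forall>n. x n \<in> {1..k}}"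
  by (auto simp: full_shift_def PiE_def Pi_def)

lemma openin_full_shift_cylinder:
  assumes "finite J" "x \<in> topspace (full_shift k)"
  shows "openin (full_shift k) {y \<in> topspace (full_shift k). \<forall>j\<in>J. y j = x j}"
proof -
  let ?V = "\<lambda>j. if j \<in> J then {x j} else {1..k}"
  have "finite {j. ?V j \<noteq> {1..k}}"
    by (rule finite_subset[OF _ assms(1)]) auto
  then have "openin (full_shift k) (PiE UNIV ?V)"
    using assms(2) unfolding full_shift_def
    by (intro product_topology_basis) (auto simp: topspace_full_shift[unfolded full_shift_def])
  also have "PiE UNIV ?V = {y \<in> topspace (full_shift k). \<forall>j\<in>J. y j = x j}"
    using assms(2) unfolding topspace_full_shift PiE_UNIV_domain Pi_def
    by (auto split: if_splits)
  finally show ?thesis .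
qed

text \<open>A word of a point of the orbit closure is read in a finite window, and the cylinder over this window
  is a neighbourhood that meets the orbit. So passing to the closure creates no new words.\<close>

lemma words_orbit_closure:
  assumes "b \<in> topspace (full_shift k)"
  shows "words n (orbit_closure k b) = range (\<lambda>i. map (\<lambda>j. b (i + int j)) [0..<n])"
proof (intro equalityI subsetI)
  fix w assume "w \<in> words n (orbit_closure k b)"
  then obtain y i where y: "y \<in> orbit_closure k b" and w: "w = map (\<lambda>j. y (i + int j)) [0..<n]"
    by (auto simp: words_def)
  have yt: "y \<in> topspace (full_shift k)"
    using y by (simp add: orbit_closure_def in_closure_of)
  let ?U = "{z \<in> topspace (full_shift k). \<forall>j\<in>{i..<i + int n}. z j = y j}"
  have "openin (full_shift k) ?U" by (rule openin_full_shift_cylinder) (use yt in auto)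
  then obtain m where m: "int_iterate shift m b \<in> ?U"
    using y[unfolded orbit_closure_def in_closure_of, THEN conjunct2, rule_format, of ?U] yt by auto
  have "w = map (\<lambda>j. b ((i + m) + int j)) [0..<n]"
    unfolding w
  proof (rule map_cong[OF refl])
    fix j assume "j \<in> set [0..<n]"
    then have "b ((i + int j) + m) = y (i + int j)" using m by (simp add: int_iterate_shift)
    then show "y (i + int j) = b ((i + m) + int j)" by (simp add: add_ac)
  qed
  then show "w \<in> range (\<lambda>i. map (\<lambda>j. b (i + int j)) [0..<n])" by (rule range_eqI)
next
  fix w assume "w \<in> range (\<lambda>i. map (\<lambda>j. b (i + int j)) [0..<n])"
  then obtain i where w: "w = map (\<lambda>j. b (i + int j)) [0..<n]" by blast
  have "{int_iterate shift m b |m. True} \<subseteq> topspace (full_shift k)"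
    using assms by (auto simp: topspace_full_shift int_iterate_shift)
  moreover have "b \<in> {int_iterate shift m b |m. True}"
    by (auto simp: int_iterate_def intro!: exI[of _ 0])
  ultimately have "b \<in> orbit_closure k b"
    unfolding orbit_closure_def using closure_of_subset by blast
  then show "w \<in> words n (orbit_closure k b)" by (auto simp: words_def w)
qed

text \<open>A window of length \<open>n\<close> meets at most \<open>n div l + 2\<close> blocks of the grid of mesh \<open>l\<close>, so it is
  determined by its offset in the grid and by the contents of these blocks.\<close>

lemma card_factors_le:
  fixes b :: "int \<Rightarrow> nat" and W :: "(nat \<Rightarrow> nat) set"
  assumes l: "0 < l" and W: "finite W"
    and blocks: "\<And>m. \<exists>w\<in>W. \<forall>r<l. b (int l * m + int r) = w r"
  shows "card (range (\<lambda>i. map (\<lambda>j. b (i + int j)) [0..<n])) \<le> l * card W ^ (n div l + 2)"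
proof -
  define q where "q = n div l + 2"
  define A where "A = {0..<l} \<times> {ws. set ws \<subseteq> W \<and> length ws = q}"
  define \<phi> :: "nat \<times> (nat \<Rightarrow> nat) list \<Rightarrow> nat list"
    where "\<phi> = (\<lambda>(r, ws). map (\<lambda>j. (ws ! ((r + j) div l)) ((r + j) mod l)) [0..<n])"
  obtain \<omega> where \<omega>: "\<And>m. \<omega> m \<in> W" "\<And>m r. r < l \<Longrightarrow> b (int l * m + int r) = \<omega> m r"
    using blocks by metis
  have finA: "finite A" using W by (auto simp: A_def finite_lists_length_eq)
  have "map (\<lambda>j. b (i + int j)) [0..<n] \<in> \<phi> ` A" for i
  proof -
    define r where "r = nat (i mod int l)"
    define ws where "ws = map (\<lambda>u. \<omega> (i div int l + int u)) [0..<q]"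
    have r: "int r = i mod int l" "r < l" using l by (auto simp: r_def nat_less_iff)
    have "b (i + int j) = (ws ! ((r + j) div l)) ((r + j) mod l)" if "j < n" for j
    proof -
      have "n < l * (n div l) + l"
        using l by (metis add.commute dividend_less_div_times mult.commute)
      then have "r + j < l * q" using r(2) that by (simp add: q_def algebra_simps)
      then have lt: "(r + j) div l < q" using l by (simp add: less_mult_imp_div_less mult.commute)
      have "i + int j = int l * (i div int l) + int (r + j)"
        using r(1) by (simp add: algebra_simps)
      also have "int (r + j) = int l * int ((r + j) div l) + int ((r + j) mod l)"
        by (metis mult_div_mod_eq of_nat_add of_nat_mult)
      finally have "i + int j = int l * (i div int l + int ((r + j) div l)) + int ((r + j) mod l)"
        by (simp add: algebra_simps)
      then have "b (i + int j) = \<omega> (i div int l + int ((r + j) div l)) ((r + j) mod l)"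
        using \<omega>(2)[of "(r + j) mod l"] l by simp
      then show ?thesis using lt by (simp add: ws_def)
    qed
    then have "map (\<lambda>j. b (i + int j)) [0..<n] = \<phi> (r, ws)" by (simp add: \<phi>_def)
    moreover have "(r, ws) \<in> A" using r \<omega>(1) by (auto simp: A_def ws_def)
    ultimately show ?thesis by blast
  qed
  then have "card (range (\<lambda>i. map (\<lambda>j. b (i + int j)) [0..<n])) \<le> card (\<phi> ` A)"
    using finA by (intro card_mono) auto
  also have "\<dots> \<le> card A" by (rule card_image_le[OF finA])
  also have "\<dots> = l * card W ^ q" using W by (simp add: A_def card_cartesian_product card_lists_length_eq)
  finally show ?thesis by (simp add: q_def)
qed

text \<open>If at some mesh \<open>l\<close> the sequence uses at most \<open>exp (\<eta> l)\<close> aligned blocks, then it has at most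
  \<open>l * exp (\<eta> (n + 2 l))\<close> words of length \<open>n\<close>, hence growth rate at most \<open>\<eta>\<close>.\<close>

lemma seq_entropy_eq_0I:
  assumes b: "b \<in> topspace (full_shift k)"
    and blocks: "\<And>\<eta>::real. \<eta> > 0 \<Longrightarrow> \<exists>l>0. \<exists>W. finite W \<and> real (card W) \<le> exp (\<eta> * real l) \<and>
      (\<forall>m. \<exists>w\<in>W. \<forall>r<l. b (int l * m + int r) = w r)"
  shows "seq_entropy k b = 0"
proof -
  define c where "c n = card (words n (orbit_closure k b))" for n
  have c: "c n = card (range (\<lambda>i. map (\<lambda>j. b (i + int j)) [0..<n]))" for n
    by (simp add: c_def words_orbit_closure[OF b])
  have c_pos: "1 \<le> c n" for n
  proof -
    have "finite (range (\<lambda>i. map (\<lambda>j. b (i + int j)) [0..<n]))"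
      by (rule finite_subset[OF _ finite_lists_length_eq[of "{1..k}" n]])
        (use b in \<open>auto simp: topspace_full_shift\<close>)
    then have "c n \<noteq> 0" unfolding c by (subst card_0_eq) auto
    then show ?thesis by simp
  qed
  have "(\<lambda>n. ln (real (c n)) / real n) \<longlonglongrightarrow> 0"
  proof (rule order_tendstoI)
    fix a :: real assume "a < 0"
    then show "\<forall>\<^sub>F n in sequentially. a < ln (real (c n)) / real n"
      using c_pos by (intro always_eventually allI order_less_le_trans[OF \<open>a < 0\<close>] divide_nonneg_nonneg ln_ge_zero) auto
  next
    fix e :: real assume e: "0 < e"
    obtain l W where l: "0 < l" and W: "finite W" "real (card W) \<le> exp (e / 2 * real l)"
      and bl: "\<And>m. \<exists>w\<in>W. \<forall>r<l. b (int l * m + int r) = w r"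
      using blocks[of "e / 2"] e by (metis half_gt_zero)
    define C where "C = ln (real l) + e * real l"
    have "W \<noteq> {}" using bl by blast
    then have W1: "1 \<le> real (card W)" using W(1) by (simp add: Suc_leI card_gt_0_iff)
    have lnW: "0 \<le> ln (real (card W))" using W1 by (rule ln_ge_zero)
    have lnW': "ln (real (card W)) \<le> e / 2 * real l"
      using W1 W(2) ln_mono[of "real (card W)" "exp (e / 2 * real l)"] by simp
    have div_le: "real (n div l) \<le> real n / real l" for n
      using l by (simp add: pos_le_divide_eq flip: of_nat_mult)
    have upper: "ln (real (c n)) / real n \<le> C / real n + e / 2" if n: "0 < n" for n
    proof -
      have "real (c n) \<le> real l * real (card W) ^ (n div l + 2)"
        using card_factors_le[OF l W(1) bl, of n] unfolding c
        by (metis of_nat_mono of_nat_mult of_nat_power)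
      then have "ln (real (c n)) \<le> ln (real l * real (card W) ^ (n div l + 2))"
        using c_pos[of n] l W1 by (subst ln_le_cancel_iff) auto
      also have "\<dots> = ln (real l) + real (n div l + 2) * ln (real (card W))"
        using l W1 by (subst ln_mult) (auto simp: ln_realpow simp del: power_Suc power_add power_add_numeral2 add_2_eq_Suc')
      also have "\<dots> \<le> ln (real l) + (real n / real l + 2) * (e / 2 * real l)"
        using lnW lnW' div_le[of n] by (intro add_left_mono mult_mono) auto
      also have "\<dots> = C + e / 2 * real n" using l by (simp add: C_def field_simps)
      finally have "ln (real (c n)) \<le> C + e / 2 * real n" .
      then have "ln (real (c n)) / real n \<le> (C + e / 2 * real n) / real n"
        by (rule divide_right_mono) simp
      then show ?thesis using n by (simp add: field_simps)
    qed
    have "(\<lambda>n. C / real n + e / 2) \<longlonglongrightarrow> 0 + e / 2"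
      by (intro tendsto_intros lim_const_over_n)
    then have "\<forall>\<^sub>F n in sequentially. C / real n + e / 2 < e"
      using e by (intro order_tendstoD(2)[of _ "0 + e / 2"]) auto
    then show "\<forall>\<^sub>F n in sequentially. ln (real (c n)) / real n < e"
      using eventually_gt_at_top[of 0]
    proof eventually_elim
      case (elim n)
      then show ?case using upper[of n] by linarith
    qed
  qed
  then show ?thesis unfolding seq_entropy_def c_def by (rule limI)
qed

text \<open>A neighbourhood in the full shift restricts finitely many coordinates only, so a common multiple
  of their periods is a return time in both directions.\<close>

lemma toeplitzI:
  assumes b: "b \<in> topspace (full_shift k)"
    and periodic: "\<And>n. \<exists>l::int. 0 < l \<and> (\<forall>d. l dvd d \<longrightarrow> b (n + d) = b n)"
  shows "toeplitz k b"
  unfolding toeplitz_def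
proof (intro conjI allI impI b)
  fix U assume U: "openin (full_shift k) U \<and> b \<in> U"
  obtain V where V: "b \<in> PiE UNIV V" "finite {i. V i \<noteq> topspace (discrete_topology {1..k})}" "PiE UNIV V \<subseteq> U"
    using product_topology_open_contains_basis[OF U[unfolded full_shift_def, THEN conjunct1] U[THEN conjunct2]]
    by metis
  define J where "J = {i. V i \<noteq> {1..k}}"
  have J: "finite J" using V(2) by (simp add: J_def)
  obtain per where per: "\<And>n. 0 < (per n :: int)" "\<And>n d. per n dvd d \<Longrightarrow> b (n + d) = b n"
    using periodic by metis
  have "int_iterate shift m b \<in> U" if m: "prod per J dvd m" for m
  proof -
    have "b (n + m) \<in> V n" for n
    proof (cases "n \<in> J")
      case True
      then have "per n dvd m" using J m by (meson dvd_prodI dvd_trans)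
      then show ?thesis using per(2) V(1) by auto
    next
      case False
      then show ?thesis using b by (auto simp: J_def topspace_full_shift)
    qed
    then show ?thesis using V(3) by (auto simp: int_iterate_shift)
  qed
  then show "\<exists>l>0. \<forall>m. l dvd m \<longrightarrow> int_iterate shift m b \<in> U"
    using per(1) by (intro exI[of _ "prod per J"]) (auto intro: prod_pos)
qed

lemma sum_half_powers: "(\<Sum>i<j. (1 / 2 :: real) ^ Suc i) = 1 - (1 / 2) ^ j"
  by (induction j) auto

section \<open>Merging stages along nested periodic windows\<close>

text \<open>Stage \<open>j\<close> owns the \<open>p j\<close>-periodic set generated by the window \<open>[- N j, N j)\<close>, and \<open>l j\<close> is the length of
  the blocks that stage \<open>j\<close> writes. The divisibility chain \<open>l j | N j | p j | l (j + 1)\<close> carries the argument: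
  read at mesh \<open>l i\<close>, the windows of the stages from \<open>i\<close> on are unions of whole blocks, while the windows
  of the stages before \<open>i\<close> cut the same pattern into every block.\<close>

locale nested_windows =
  fixes l N p :: "nat \<Rightarrow> nat"
  assumes l_pos: "0 < l j" and p_pos: "0 < p j" and N_gt: "j < N j"
    and l_dvd_N: "l j dvd N j" and N_dvd_p: "N j dvd p j" and p_dvd_l_Suc: "p j dvd l (Suc j)"
begin

lemma l_dvd_p: "l j dvd p j"
  using l_dvd_N N_dvd_p dvd_trans by blast

lemma l_dvd_l: "i \<le> j \<Longrightarrow> l i dvd l j"
  by (induction rule: dec_induct) (simp, meson dvd_trans l_dvd_p p_dvd_l_Suc)

lemma p_dvd_l: "i < j \<Longrightarrow> p i dvd l j"
  using l_dvd_l[of "Suc i" j] p_dvd_l_Suc[of i] by (auto intro: dvd_trans)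

lemma p_dvd_p: "i \<le> j \<Longrightarrow> p i dvd p j"
  using p_dvd_l[of i j] l_dvd_p[of j] by (cases "i = j") (auto intro: dvd_trans)

definition window :: "nat \<Rightarrow> int set" where
  "window j = {n. (n + int (N j)) mod int (p j) < 2 * int (N j)}"

definition stage :: "int \<Rightarrow> nat" where
  "stage n = (LEAST j. n \<in> window j)"

text \<open>Where windows overlap, the earliest stage wins. Each stage is made periodic by reading it modulo its
  own period, which also supplies the values at negative positions.\<close>

definition merge :: "(nat \<Rightarrow> nat \<Rightarrow> 'b) \<Rightarrow> int \<Rightarrow> 'b" where
  "merge s n = s (stage n) (nat (n mod int (p (stage n))))"

lemma window_periodic:
  assumes "int (p j) dvd d"
  shows "n + d \<in> window j \<longleftrightarrow> n \<in> window j"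
proof -
  from assms obtain c where "d = int (p j) * c" by auto
  then have "(n + d + int (N j)) mod int (p j) = (n + int (N j)) mod int (p j)"
    by (metis add.commute add.left_commute mod_mult_self2)
  then show ?thesis by (simp add: window_def)
qed

lemma mem_window: "- int (N j) \<le> n \<Longrightarrow> n < int (N j) \<Longrightarrow> n \<in> window j"
  using zmod_le_nonneg_dividend[of "n + int (N j)" "int (p j)"] by (simp add: window_def)

lemma stage_mem: "n \<in> window (stage n)"
proof -
  have "n \<in> window (nat \<bar>n\<bar>)" using N_gt[of "nat \<bar>n\<bar>"] by (intro mem_window) linarith+
  then show ?thesis unfolding stage_def by (rule LeastI)
qed

lemma stage_eqI: "n \<in> window j \<Longrightarrow> (\<And>i. i < j \<Longrightarrow> n \<notin> window i) \<Longrightarrow> stage n = j"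
  unfolding stage_def by (rule Least_equality) (auto simp: not_less[symmetric])

lemma not_mem_window_less_stage: "i < stage n \<Longrightarrow> n \<notin> window i"
  unfolding stage_def by (rule not_less_Least)

text \<open>All windows up to the stage of \<open>n\<close> are invariant under multiples of the period of that stage, so the
  translates of \<open>n\<close> belong to the same stage. This gives every position its own period, which is regular
  recurrence.\<close>

lemma merge_periodic:
  assumes "int (p (stage n)) dvd d"
  shows "merge s (n + d) = merge s n"
proof -
  have "stage (n + d) = stage n"
  proof (rule stage_eqI)
    show "n + d \<in> window (stage n)" using assms stage_mem by (simp add: window_periodic)
    fix i assume i: "i < stage n"
    then have "int (p i) dvd d" using assms p_dvd_p[of i "stage n"] by (meson dvd_trans less_imp_le of_nat_dvd_iff)
    then show "n + d \<notin> window i" using i by (simp add: window_periodic not_mem_window_less_stage)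
  qed
  moreover have "(n + d) mod int (p (stage n)) = n mod int (p (stage n))"
    using assms by (auto elim!: dvdE)
  ultimately show ?thesis by (simp add: merge_def)
qed

text \<open>Reduction modulo \<open>p j\<close> respects the grid of mesh \<open>l i\<close>: it moves blocks and keeps offsets.\<close>

lemma mod_p_add:
  assumes "i \<le> j" "r < l i"
  shows "(int (l i) * m + int r) mod int (p j) = int (l i) * (m mod int (p j div l i)) + int r"
proof -
  define q where "q = p j div l i"
  have p: "p j = l i * q" using l_dvd_l[OF assms(1)] l_dvd_p[of j] dvd_trans by (fastforce simp: q_def)
  have q: "0 < q" using p p_pos[of j] by (cases q) auto
  have "int (l i) * (m mod int q) + int r < int (l i) * (m mod int q) + int (l i)" using assms(2) by simp
  also have "\<dots> = int (l i) * (m mod int q + 1)" by (simp add: algebra_simps)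
  also have "\<dots> \<le> int (l i) * int q" using q pos_mod_bound[of "int q" m] by (intro mult_left_mono) linarith+
  finally have lt: "int (l i) * (m mod int q) + int r < int (p j)" by (simp add: p)
  have "int (l i) * m + int r = int (p j) * (m div int q) + (int (l i) * (m mod int q) + int r)"
  proof -
    have "int (l i) * m = int (l i) * (int q * (m div int q) + m mod int q)" by (simp only: mult_div_mod_eq)
    then show ?thesis by (simp only: p of_nat_mult distrib_left mult.assoc add.assoc)
  qed
  then have "(int (l i) * m + int r) mod int (p j) = (int (l i) * (m mod int q) + int r) mod int (p j)"
    by (simp only: mod_mult_self4)
  also have "\<dots> = int (l i) * (m mod int q) + int r"
    using lt q by (intro mod_pos_pos_trivial) auto
  finally show ?thesis by (simp add: q_def)
qed

lemma window_block:
  assumes "i \<le> j" "r < l i"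
  shows "int (l i) * m + int r \<in> window j \<longleftrightarrow> int (l i) * m \<in> window j"
proof -
  obtain c where c: "N j = l i * c" using l_dvd_l[OF assms(1)] l_dvd_N[of j] dvd_trans by blast
  define u where "u = (m + int c) mod int (p j div l i)"
  have eq: "(int (l i) * m + int s + int (N j)) mod int (p j) = int (l i) * u + int s" if "s < l i" for s
    using mod_p_add[OF assms(1) that, of "m + int c"] by (simp add: c u_def algebra_simps)
  have "int (l i) * u + int r < 2 * int (N j) \<longleftrightarrow> int (l i) * u < int (l i) * (2 * int c)"
  proof
    assume "int (l i) * u < int (l i) * (2 * int c)"
    then have "u + 1 \<le> 2 * int c" using l_pos[of i] by simp
    then have "int (l i) * (u + 1) \<le> int (l i) * (2 * int c)" by (intro mult_left_mono) auto
    then show "int (l i) * u + int r < 2 * int (N j)" using assms(2) by (simp add: c algebra_simps)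
  qed (simp add: c algebra_simps)
  then show ?thesis using eq[OF assms(2)] eq[of 0] l_pos[of i] by (simp add: window_def c algebra_simps)
qed

text \<open>Within a block of mesh \<open>l i\<close>, the positions taken by stages before \<open>i\<close> and the values there depend on
  the offset only, because \<open>l i\<close> is a multiple of the periods of these stages. All other positions of the
  block are written by one common stage \<open>t \<ge> i\<close>. Thus merging imposes one fixed mask on the blocks of the
  stages from \<open>i\<close> on and does not increase their number.\<close>

lemma merge_block:
  assumes W: "\<And>t m. i \<le> t \<Longrightarrow> \<exists>w\<in>W. \<forall>r<l i. s t (l i * m + r) = w r"
  shows "\<exists>w\<in>(\<lambda>w r. if \<exists>t<i. int r \<in> window t then merge s (int r) else w r) ` W.
           \<forall>r<l i. merge s (int (l i) * m + int r) = w r"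
proof -
  \<comment> \<open>Stage \<open>t\<close> is the common stage of the positions of the block left over by the stages before \<open>i\<close>.\<close>
  define S where "S t \<longleftrightarrow> i \<le> t \<and> int (l i) * m \<in> window t" for t
  define t where "t = (LEAST t. S t)"
  let ?j = "max i (nat \<bar>int (l i) * m\<bar>)"
  have "S ?j" unfolding S_def using N_gt[of ?j] by (intro conjI mem_window) linarith+
  then have t: "S t" unfolding t_def by (rule LeastI)
  have it: "i \<le> t" using t by (simp add: S_def)
  have t_min: "\<not> S u" if "u < t" for u using that unfolding t_def by (rule not_less_Least)
  define m' where "m' = nat (m mod int (p t div l i))"
  have pd: "0 < p t div l i"
    using l_dvd_l[OF it] l_dvd_p[of t] p_pos[of t] by (metis dvd_div_eq_0_iff dvd_trans gr0I less_irrefl)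
  obtain w where w: "w \<in> W" "\<And>r. r < l i \<Longrightarrow> s t (l i * m' + r) = w r"
    using W[OF it, of m'] by blast
  have "merge s (int (l i) * m + int r) = (if \<exists>t<i. int r \<in> window t then merge s (int r) else w r)"
    if r: "r < l i" for r
  proof -
    have low: "int (l i) * m + int r \<in> window u \<longleftrightarrow> int r \<in> window u" if "u < i" for u
      using window_periodic[of u "int (l i) * m" "int r"] p_dvd_l[OF that] by (simp add: add.commute)
    show ?thesis
    proof (cases "\<exists>u<i. int r \<in> window u")
      case True
      then have "stage (int r) < i" using not_mem_window_less_stage by (meson linorder_not_less order_less_le_trans)
      then have "int (p (stage (int r))) dvd int (l i) * m" by (simp add: p_dvd_l)
      then show ?thesis using merge_periodic[of "int r" "int (l i) * m" s] True by (simp add: add.commute)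
    next
      case False
      have "stage (int (l i) * m + int r) = t"
      proof (rule stage_eqI)
        show "int (l i) * m + int r \<in> window t" using t window_block[OF it r] by (simp add: S_def)
        fix u assume u: "u < t"
        show "int (l i) * m + int r \<notin> window u"
          using t_min[OF u] False low[of u] window_block[of i u r m] r by (cases "u < i") (auto simp: S_def)
      qed
      moreover have "nat ((int (l i) * m + int r) mod int (p t)) = l i * m' + r"
        using pd by (simp add: mod_p_add[OF it r] m'_def nat_add_distrib nat_mult_distrib)
      ultimately show ?thesis unfolding if_not_P[OF False] using w(2)[OF r] by (simp add: merge_def)
    qed
  qed
  then show ?thesis by (intro bexI[OF _ imageI[OF w(1)]]) auto
qed

lemma merge_eq_stage:
  assumes "n < N j" "\<And>i. i < j \<Longrightarrow> int n \<notin> window i"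
  shows "merge s (int n) = s j n"
proof -
  have "stage (int n) = j" using assms by (intro stage_eqI mem_window) auto
  moreover have "n < p j" using assms(1) N_dvd_p[of j] p_pos[of j] by (meson dvd_imp_le order_less_le_trans)
  ultimately show ?thesis by (simp add: merge_def)
qed

lemma card_window_le: "card {n. n < q * p i \<and> int n \<in> window i} \<le> q * (2 * N i)"
proof (induction q)
  case (Suc q)
  let ?A = "{n. n < q * p i \<and> int n \<in> window i}" and ?B = "{n \<in> {q * p i..<q * p i + p i}. int n \<in> window i}"
  have "inj_on (\<lambda>n. (n + N i) mod p i) ?B"
  proof (rule inj_onI)
    fix a b assume ab: "a \<in> ?B" "b \<in> ?B" "(a + N i) mod p i = (b + N i) mod p i"
    then have "int (a + N i) mod int (p i) = int (b + N i) mod int (p i)" by (simp only: of_nat_mod[symmetric])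
    then have "int (p i) dvd int a - int b" by (simp add: mod_eq_dvd_iff)
    moreover have "\<bar>int a - int b\<bar> < int (p i)" using ab(1,2) by auto
    ultimately show "a = b" using dvd_imp_le_int[of "int a - int b" "int (p i)"] by auto
  qed
  moreover have "(\<lambda>n. (n + N i) mod p i) ` ?B \<subseteq> {..<2 * N i}"
  proof (rule image_subsetI)
    fix n assume "n \<in> ?B"
    then have "int n \<in> window i" by simp
    then have "int ((n + N i) mod p i) < int (2 * N i)" by (simp add: window_def zmod_int)
    then show "(n + N i) mod p i \<in> {..<2 * N i}" by (simp only: of_nat_less_iff lessThan_iff)
  qed
  ultimately have "card ?B \<le> card {..<2 * N i}" by (rule card_inj_on_le) simp
  moreover have "{n. n < Suc q * p i \<and> int n \<in> window i} = ?A \<union> ?B"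
    by (simp add: set_eq_iff) linarith
  ultimately show ?case using Suc card_Un_le[of ?A ?B] by simp
qed simp

text \<open>The earlier window \<open>i\<close> has density at most \<open>2 * N i / p i\<close>, and \<open>p i\<close> divides \<open>N j\<close>, so the count in
  \<open>[0, N j)\<close> obeys this density without boundary error. The hypothesis makes the densities a geometric series
  of sum at most \<open>\<theta>\<close>.\<close>

lemma card_overridden_le:
  fixes \<theta> :: real
  assumes \<theta>: "\<And>i. 2 ^ (i + 2) * real (N i) \<le> \<theta> * real (p i)"
  shows "real (card {n. n < N j \<and> (\<exists>i<j. int n \<in> window i)}) \<le> \<theta> * real (N j)"
proof -
  have \<theta>0: "0 \<le> \<theta>" using \<theta>[of 0] p_pos[of 0] by 
    (smt (verit) of_nat_0_le_iff of_nat_0_less_iff power_0 mult_neg_pos mult_nonneg_nonneg zero_le_power)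
  have "{n. n < N j \<and> (\<exists>i<j. int n \<in> window i)} = (\<Union>i<j. {n. n < N j \<and> int n \<in> window i})" by blast
  then have "real (card {n. n < N j \<and> (\<exists>i<j. int n \<in> window i)}) \<le> (\<Sum>i<j. real (card {n. n < N j \<and> int n \<in> window i}))"
    using card_UN_le[of "{..<j}" "\<lambda>i. {n. n < N j \<and> int n \<in> window i}"] by (simp flip: of_nat_sum)
  also have "\<dots> \<le> (\<Sum>i<j. \<theta> * real (N j) * (1 / 2) ^ Suc i)"
  proof (rule sum_mono)
    fix i assume "i \<in> {..<j}"
    then have "p i dvd N j" using p_dvd_l[of i j] l_dvd_N[of j] by (auto intro: dvd_trans)
    then obtain q where q: "N j = q * p i" by (metis dvdE mult.commute)
    have "real (card {n. n < N j \<and> int n \<in> window i}) \<le> real (q * (2 * N i))"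
      using card_window_le[of q i] by (simp only: q of_nat_le_iff)
    also have "\<dots> = real q * (2 ^ (i + 2) * real (N i)) * (1 / 2) ^ Suc i" by (simp add: power_divide field_simps)
    also have "\<dots> \<le> real q * (\<theta> * real (p i)) * (1 / 2) ^ Suc i"
      using \<theta>[of i] by (intro mult_right_mono mult_left_mono) auto
    finally show "real (card {n. n < N j \<and> int n \<in> window i}) \<le> \<theta> * real (N j) * (1 / 2) ^ Suc i"
      by (simp add: q mult_ac)
  qed
  also have "\<dots> = \<theta> * real (N j) * (1 - (1 / 2) ^ j)"
    by (simp only: sum_distrib_left[symmetric] sum_half_powers)
  also have "\<dots> \<le> \<theta> * real (N j) * 1" using \<theta>0 by (intro mult_left_mono) auto
  finally show ?thesis by simp
qed

end

section \<open>Shadowing orbits by concatenations of few blocks\<close>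

text \<open>Compactness yields a finite cover by open Bowen balls. Existence means that the minimum which
  defines the spanning number is attained, so that bounds on this number yield actual spanning sets.\<close>

lemma spanning_set_exists:
  fixes X :: "'a::metric_space set"
  assumes X: "compact X" and T: "continuous_on X T" "T ` X \<subseteq> X" and \<epsilon>: "0 < \<epsilon>"
  shows "\<exists>F. spanning_set X T n \<epsilon> F"
proof -
  have iter: "continuous_on X (T ^^ i) \<and> (T ^^ i) ` X \<subseteq> X" for i
  proof (induction i)
    case (Suc i)
    then have "continuous_on X (T \<circ> (T ^^ i))"
      by (intro continuous_on_compose continuous_on_subset[OF T(1)]) auto
    then show ?case using Suc T(2) by (auto simp: image_subset_iff)
  qed (auto simp: continuous_on_id)
  define B where "B y = {x \<in> X. \<forall>i<n. dist ((T ^^ i) x) ((T ^^ i) y) < \<epsilon>}" for y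
  have open_B: "openin (top_of_set X) (B y)" for y
  proof -
    have "openin (top_of_set X) {x \<in> X. \<forall>i<k. dist ((T ^^ i) x) ((T ^^ i) y) < \<epsilon>}" for k
    proof (induction k)
      case (Suc k)
      have "openin (top_of_set X) (X \<inter> (T ^^ k) -` ball ((T ^^ k) y) \<epsilon>)"
        using iter[of k] by (intro continuous_openin_preimage_gen) auto
      moreover have "{x \<in> X. \<forall>i<Suc k. dist ((T ^^ i) x) ((T ^^ i) y) < \<epsilon>} =
          {x \<in> X. \<forall>i<k. dist ((T ^^ i) x) ((T ^^ i) y) < \<epsilon>} \<inter> (X \<inter> (T ^^ k) -` ball ((T ^^ k) y) \<epsilon>)"
        by (auto simp: less_Suc_eq dist_commute)
      ultimately show ?case using Suc by (simp add: openin_Int)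
    qed simp
    then show ?thesis by (simp add: B_def)
  qed
  have "X \<subseteq> (\<Union>y\<in>X. B y)" using \<epsilon> by (auto simp: B_def)
  then obtain \<D> where "\<D> \<subseteq> B ` X" "finite \<D>" "X \<subseteq> \<Union>\<D>"
    using X[unfolded compact_eq_openin_cover, rule_format, of "B ` X"] open_B by auto
  then obtain F where F: "F \<subseteq> X" "finite F" "\<D> = B ` F" by (meson finite_subset_image)
  have "spanning_set X T n \<epsilon> F"
    using F \<open>X \<subseteq> \<Union>\<D>\<close> unfolding spanning_set_def B_def by blast
  then show ?thesis by blast
qed

lemma spanning_sets_small_of_zero_entropy:
  fixes X :: "'a::metric_space set"
  assumes sys: "top_dyn_system X T" and X: "X \<noteq> {}" and ent: "topological_entropy X T = 0"
    and "0 < \<epsilon>" "0 < \<eta>"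
  shows "\<forall>\<^sub>F n in sequentially. \<exists>F. spanning_set X T n \<epsilon> F \<and> real (card F) \<le> exp (\<eta> * real n)"
proof -
  let ?r = "\<lambda>n. ereal (ln (real (spanning_number X T n \<epsilon>)) / real n)"
  have "limsup ?r \<le> topological_entropy X T"
    unfolding topological_entropy_def using \<open>0 < \<epsilon>\<close> by (intro SUP_upper) auto
  also have "\<dots> < ereal \<eta>" using ent \<open>0 < \<eta>\<close> by simp
  finally have "\<forall>\<^sub>F n in sequentially. ?r n < ereal \<eta>" by (rule Limsup_lessD)
  then show ?thesis using eventually_gt_at_top[of 0]
  proof eventually_elim
    case (elim n)
    have "\<exists>F. spanning_set X T n \<epsilon> F"
      using sys \<open>0 < \<epsilon>\<close> unfolding top_dyn_system_def homeomorphism_def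
      by (intro spanning_set_exists) auto
    then have "\<exists>c F. spanning_set X T n \<epsilon> F \<and> card F = c" by blast
    then obtain F where F: "spanning_set X T n \<epsilon> F" "card F = spanning_number X T n \<epsilon>"
      unfolding spanning_number_def by (rule LeastI_ex[THEN exE]) blast
    have "finite F" "F \<noteq> {}" using F(1) X by (auto simp: spanning_set_def)
    then have pos: "0 < real (card F)" by (simp add: card_gt_0_iff)
    have "ln (real (card F)) < \<eta> * real n" using elim F(2) by (simp add: divide_less_eq)
    then have "exp (ln (real (card F))) \<le> exp (\<eta> * real n)" by simp
    then show ?case using F(1) pos by auto
  qed
qed

text \<open>For level \<open>j + 1\<close>, the orbit of \<open>y\<close> is cut into blocks of length \<open>l j\<close>. Each block is
  replaced by the initial block of the level-\<open>j\<close> sequence of the centre that \<open>\<pi> j\<close> assigns to its starting point. The recursion runs through all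
  shorter lengths, since replacing the orbit at length \<open>l j\<close> alone would give no control on the number of
  blocks of length \<open>l i\<close> for \<open>i < j\<close>.\<close>

fun pseudo_orbit :: "('a \<Rightarrow> 'a) \<Rightarrow> (nat \<Rightarrow> nat) \<Rightarrow> (nat \<Rightarrow> 'a \<Rightarrow> 'a) \<Rightarrow> nat \<Rightarrow> 'a \<Rightarrow> nat \<Rightarrow> 'a" where
  "pseudo_orbit T l \<pi> 0 y n = (T ^^ n) y"
| "pseudo_orbit T l \<pi> (Suc j) y n =
     pseudo_orbit T l \<pi> j (\<pi> j ((T ^^ (l j * (n div l j))) y)) (n mod l j)"

locale block_shadowing =
  fixes X :: "'a::metric_space set" and T :: "'a \<Rightarrow> 'a"
    and l :: "nat \<Rightarrow> nat" and \<epsilon> :: "nat \<Rightarrow> real" and F :: "nat \<Rightarrow> 'a set" and \<pi> :: "nat \<Rightarrow> 'a \<Rightarrow> 'a"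
  assumes T_in: "y \<in> X \<Longrightarrow> T y \<in> X"
    and l_pos: "0 < l j" and l_dvd: "l j dvd l (Suc j)"
    and F_sub: "F j \<subseteq> X" and \<pi>_in: "y \<in> X \<Longrightarrow> \<pi> j y \<in> F j"
    and \<pi>_close: "y \<in> X \<Longrightarrow> i < l j \<Longrightarrow> dist ((T ^^ i) y) ((T ^^ i) (\<pi> j y)) < \<epsilon> j"
begin

abbreviation "P \<equiv> pseudo_orbit T l \<pi>"

lemma iter_in: "y \<in> X \<Longrightarrow> (T ^^ i) y \<in> X"
  by (induction i) (auto simp: T_in)

lemma \<pi>_in_X: "y \<in> X \<Longrightarrow> \<pi> j y \<in> X"
  using \<pi>_in F_sub by blast

lemma pseudo_orbit_in: "y \<in> X \<Longrightarrow> P j y n \<in> X"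
  by (induction j arbitrary: y n) (auto simp: iter_in \<pi>_in_X)

text \<open>Each level adds the error of one replacement. The error does not accumulate with the time \<open>n\<close>, because
  every block starts afresh from the true orbit.\<close>

lemma pseudo_orbit_shadows: "y \<in> X \<Longrightarrow> dist (P j y n) ((T ^^ n) y) \<le> (\<Sum>i<j. \<epsilon> i)"
proof (induction j arbitrary: y n)
  case (Suc j)
  let ?y = "(T ^^ (l j * (n div l j))) y" and ?r = "n mod l j"
  have y: "?y \<in> X" using Suc.prems by (rule iter_in)
  have "(T ^^ n) y = (T ^^ ?r) ?y"
    by (simp flip: funpow_add[THEN fun_cong, unfolded comp_apply])
  then have "dist (P (Suc j) y n) ((T ^^ n) y) \<le>
      dist (P j (\<pi> j ?y) ?r) ((T ^^ ?r) (\<pi> j ?y)) + dist ((T ^^ ?r) ?y) ((T ^^ ?r) (\<pi> j ?y))"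
    by (simp add: dist_triangle2)
  also have "\<dots> \<le> (\<Sum>i<j. \<epsilon> i) + \<epsilon> j"
    using Suc.IH[OF \<pi>_in_X[OF y]] \<pi>_close[OF y, of ?r j] l_pos[of j] by (intro add_mono) auto
  finally show ?case by simp
qed simp

text \<open>At the level after \<open>i\<close> every aligned block of length \<open>l i\<close> is, by construction, an initial block of the
  sequence of a point of \<open>F i\<close>. Later levels copy whole blocks of this length, since \<open>l i\<close> divides their
  block lengths.\<close>

lemma pseudo_orbit_block:
  assumes "i < j" "y \<in> X"
  shows "\<exists>z\<in>F i. \<forall>r<l i. P j y (l i * m + r) = P i z r"
  using assms
proof (induction j arbitrary: y m)
  case (Suc j)
  have y: "(T ^^ k) y \<in> X" for k using Suc.prems(2) by (rule iter_in)
  show ?case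
  proof (cases "i = j")
    case True
    then show ?thesis using \<pi>_in[OF y[of "l i * m"], of i] by (intro bexI) auto
  next
    case False
    then have ij: "i < j" using Suc.prems(1) by simp
    have "l i dvd l j" using less_imp_le[OF ij]
      by (induction rule: dec_induct) (simp, meson dvd_trans l_dvd)
    then obtain q where q: "l j = l i * q" by blast
    have q0: "0 < q" using q l_pos[of j] by (cases q) auto
    define u where "u = l j * (m div q)"
    have lt: "l i * (m mod q) + r < l j" if "r < l i" for r
    proof -
      have "l i * (m mod q) + r < l i * (m mod q + 1)" using that by simp
      also have "\<dots> \<le> l i * q" using q0 by (intro mult_le_mono2) (simp add: Suc_leI)
      finally show ?thesis by (simp add: q)
    qed
    have eq: "l i * m + r = l j * (m div q) + (l i * (m mod q) + r)" for r
    proof -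
      have "l i * m = l i * (q * (m div q) + m mod q)" by (simp only: mult_div_mod_eq)
      then show ?thesis by (simp only: q distrib_left mult.assoc add.assoc)
    qed
    have step: "P (Suc j) y (l i * m + r) = P j (\<pi> j ((T ^^ u) y)) (l i * (m mod q) + r)" if "r < l i" for r
    proof -
      have "(l i * m + r) div l j = m div q" "(l i * m + r) mod l j = l i * (m mod q) + r"
        using lt[OF that] l_pos[of j] by (simp_all only: eq div_mult_self4 mod_mult_self4) auto
      then show ?thesis by (simp add: u_def)
    qed
    show ?thesis using Suc.IH[OF ij \<pi>_in_X[OF y[of u]], of j "m mod q"] step by auto
  qed
qed simp

end

section \<open>Toeplitz approximation of a zero-entropy orbit\<close>

text \<open>The orbit is followed on ever longer windows, each ending just beyond a prescribed time \<open>M \<in> S\<close>. Stage \<open>j\<close>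
  writes into its window the quantised pseudo-orbit of level \<open>j + 1\<close>, and the stages are merged. Up to time
  \<open>M\<close> the merged sequence differs from the orbit by the quantisation and shadowing errors, except on the set
  of small density that belongs to earlier stages. Letting the windows end near times in \<open>S\<close> makes the initial segments that are compared consist, up to a factor 2, of whole periods
  of the earlier stages.\<close>

lemma toeplitz_approximation:
  fixes X :: "'a::metric_space set" and g :: "'a \<Rightarrow> real"
  assumes sys: "top_dyn_system X T" and ent: "topological_entropy X T = 0"
    and g: "continuous_on X g" and x: "x \<in> X"
    and S: "\<And>n. \<exists>M\<ge>n. M \<in> S" and \<delta>: "0 < \<delta>"
  shows "\<exists>k\<ge>2. \<exists>b \<alpha> \<beta>. toeplitz k b \<and> seq_entropy k b = 0 \<and>
    (\<forall>n0. \<exists>M\<ge>n0. M \<in> S \<and>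
      (\<Sum>n=1..M. \<bar>g ((T ^^ n) x) - (\<alpha> * real (b (int n)) + \<beta>)\<bar>) \<le> \<delta> * real M)"
proof -
  have X: "compact X" using sys by (simp add: top_dyn_system_def)
  have T_in: "T y \<in> X" if "y \<in> X" for y
    using sys that by (auto simp: top_dyn_system_def homeomorphism_def)
  obtain C where C: "0 < C" "\<And>y. y \<in> X \<Longrightarrow> \<bar>g y\<bar> \<le> C"
    using compact_imp_bounded[OF compact_continuous_image[OF g X]] by (auto simp: bounded_pos)
  \<comment> \<open>The mesh \<open>\<tau>\<close> pays for quantisation and shadowing, \<open>2 * \<tau> = \<delta> / 2\<close> per position. The positions
    of earlier stages have density at most \<open>2 * \<theta>\<close> below \<open>M j\<close> and cost at most \<open>2 * C + \<tau>\<close> each.\<close>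
  define \<tau> where "\<tau> = \<delta> / 4"
  define \<theta> where "\<theta> = \<delta> / (4 * (2 * C + \<tau>))"
  have \<tau>: "0 < \<tau>" and \<theta>: "0 < \<theta>" using \<delta> C(1) by (auto simp: \<tau>_def \<theta>_def add_pos_pos)
  obtain e where e: "0 < e" "\<And>y z. y \<in> X \<Longrightarrow> z \<in> X \<Longrightarrow> dist y z < e \<Longrightarrow> \<bar>g y - g z\<bar> < \<tau>"
    using compact_uniformly_continuous[OF g X] \<tau> unfolding uniformly_continuous_on_def dist_real_def
    by (metis abs_minus_commute dist_commute)
  obtain K :: nat where K: "1 / \<theta> < real K" using reals_Archimedean2 by blast
  then have K\<theta>: "1 \<le> \<theta> * real K" using \<theta> by (simp add: field_simps)
  have K0: "0 < K" using K\<theta> by (cases K) auto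
  define \<epsilon> where "\<epsilon> j = e / 2 * (1 / 2) ^ Suc j" for j
  have \<epsilon>: "0 < \<epsilon> j" for j using e(1) by (simp add: \<epsilon>_def)
  have sum_\<epsilon>: "(\<Sum>i<j. \<epsilon> i) < e" for j
  proof -
    have "(\<Sum>i<j. \<epsilon> i) = e / 2 * (1 - (1 / 2) ^ j)"
      by (simp only: \<epsilon>_def sum_distrib_left[symmetric] sum_half_powers)
    also have "\<dots> \<le> e / 2 * 1" using e(1) by (intro mult_left_mono) auto
    finally show ?thesis using e(1) by simp
  qed
  \<comment> \<open>The sequences are chosen recursively. The next pair consists of a block length divisible by the current
    period and long enough for a small spanning set, and a time in \<open>S\<close> beyond it. The window end is the
    first multiple of the block length after that time.\<close>
  define end_of where "end_of = (\<lambda>(l :: nat, M :: nat). l * (M div l + 1))"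
  define period where "period j lM = end_of lM * (K * 2 ^ (j + 2))" for j lM
  define good where "good j = (\<lambda>(l, M). 0 < l \<and> l \<le> M \<and> j \<le> M \<and> M \<in> S \<and>
     (\<exists>F. spanning_set X T l (\<epsilon> j) F \<and> real (card F) \<le> exp (1 / real (Suc j) * real l)))" for j
  have good_ex: "\<exists>lM. good j lM \<and> d dvd fst lM" if d: "0 < d" for j d
  proof -
    have "\<forall>\<^sub>F n in sequentially. \<exists>F. spanning_set X T n (\<epsilon> j) F \<and> real (card F) \<le> exp (1 / real (Suc j) * real n)"
      using x by (intro spanning_sets_small_of_zero_entropy sys ent \<epsilon>) auto
    then obtain n0 where n0: "\<And>n. n0 \<le> n \<Longrightarrow>
        \<exists>F. spanning_set X T n (\<epsilon> j) F \<and> real (card F) \<le> exp (1 / real (Suc j) * real n)"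
      unfolding eventually_sequentially by blast
    define l where "l = d * Suc n0"
    have "1 * n0 \<le> d * Suc n0" using d by (intro mult_le_mono) auto
    then have l: "n0 \<le> l" "0 < l" using d by (auto simp: l_def)
    obtain M where "max l j \<le> M" "M \<in> S" using S by blast
    then have "good j (l, M)" using n0[OF l(1)] l(2) by (simp add: good_def)
    then show ?thesis by (intro exI[of _ "(l, M)"]) (simp add: l_def)
  qed
  have period_pos: "0 < period j lM" if "good j lM" for j lM
    using that K0 by (auto simp: period_def end_of_def good_def)
  obtain lM where lM: "\<And>j. good j (lM j)" "\<And>j. period j (lM j) dvd fst (lM (Suc j))"
  proof -
    have "\<exists>f. \<forall>j. good j (f j) \<and> period j (f j) dvd fst (f (Suc j))"
    proof (rule dependent_nat_choice)
      show "\<exists>y. good 0 y" using good_ex[of 1 0] by auto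
      show "\<exists>z. good (Suc j) z \<and> period j y dvd fst z" if "good j y" for j y
        using good_ex[OF period_pos[OF that]] .
    qed
    then obtain f where "\<forall>j. good j (f j) \<and> period j (f j) dvd fst (f (Suc j))" ..
    then show ?thesis by (intro that[of f]) auto
  qed
  define l where "l j = fst (lM j)" for j
  define M where "M j = snd (lM j)" for j
  define N where "N j = l j * (M j div l j + 1)" for j
  define p where "p j = N j * (K * 2 ^ (j + 2))" for j
  have period_eq: "period j (lM j) = p j" for j
    by (simp add: period_def end_of_def p_def N_def l_def M_def split: prod.split)
  have l_pos: "0 < l j" and l_le_M: "l j \<le> M j" and M_ge: "j \<le> M j" and M_S: "M j \<in> S" for j
    using lM(1)[of j] by (auto simp: good_def l_def M_def split: prod.splits)
  have "\<exists>F. spanning_set X T (l j) (\<epsilon> j) F \<and> real (card F) \<le> exp (1 / real (Suc j) * real (l j))" for j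
    using lM(1)[of j] by (auto simp: good_def l_def split: prod.splits)
  then obtain F where F: "\<And>j. spanning_set X T (l j) (\<epsilon> j) (F j)"
      "\<And>j. real (card (F j)) \<le> exp (1 / real (Suc j) * real (l j))"
    by metis
  have pi_ex: "\<exists>z. y \<in> X \<longrightarrow> z \<in> F j \<and> (\<forall>i<l j. dist ((T ^^ i) y) ((T ^^ i) z) < \<epsilon> j)" for j y
    using F(1)[of j] unfolding spanning_set_def by blast
  define \<pi> where "\<pi> j y = (SOME z. y \<in> X \<longrightarrow> z \<in> F j \<and>
      (\<forall>i<l j. dist ((T ^^ i) y) ((T ^^ i) z) < \<epsilon> j))" for j y
  have \<pi>: "y \<in> X \<longrightarrow> \<pi> j y \<in> F j \<and> (\<forall>i<l j. dist ((T ^^ i) y) ((T ^^ i) (\<pi> j y)) < \<epsilon> j)" for j y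
    unfolding \<pi>_def by (rule someI_ex[OF pi_ex])
  have M_lt_N: "M j < N j" for j
    using dividend_less_times_div[OF l_pos[of j], of "M j"]
    by (simp only: N_def distrib_left mult_1_right add.commute)
  have N_le: "N j \<le> 2 * M j" for j
    using times_div_less_eq_dividend[of "l j" "M j"] l_le_M[of j]
    unfolding N_def distrib_left by linarith
  have N_pos: "0 < N j" for j using M_lt_N[of j] by simp
  interpret W: nested_windows l N p
  proof
    fix j
    show "0 < l j" by (rule l_pos)
    show "0 < p j" using N_pos K0 by (simp add: p_def)
    show "j < N j" using M_ge[of j] M_lt_N[of j] by simp
    show "l j dvd N j" by (simp add: N_def)
    show "N j dvd p j" by (simp add: p_def)
    show "p j dvd l (Suc j)" using lM(2)[of j] by (simp add: period_eq l_def)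
  qed
  interpret B: block_shadowing X T l \<epsilon> F \<pi>
  proof
    show "l j dvd l (Suc j)" for j by (rule W.l_dvd_l) simp
    show "F j \<subseteq> X" for j using F(1)[of j] by (simp add: spanning_set_def)
  qed (use \<pi> T_in l_pos in auto)
  \<comment> \<open>The summand 1 hidden in the successor puts the code into \<open>{1..k}\<close>; it reappears as \<open>- \<tau>\<close> in the
    affine map that decodes.\<close>
  define code where "code y = Suc (nat \<lfloor>(g y + C) / \<tau>\<rfloor>)" for y
  define s where "s j n = code (B.P (Suc j) x n)" for j n
  define b where "b = W.merge s"
  define k where "k = nat \<lfloor>2 * C / \<tau>\<rfloor> + 2"
  have code_range: "code y \<in> {1..k}" if "y \<in> X" for y
  proof -
    have "(g y + C) / \<tau> \<le> 2 * C / \<tau>" using C(2)[OF that] \<tau> by (intro divide_right_mono) auto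
    then have "nat \<lfloor>(g y + C) / \<tau>\<rfloor> \<le> nat \<lfloor>2 * C / \<tau>\<rfloor>" by (intro nat_mono floor_mono)
    then show ?thesis by (simp add: code_def k_def)
  qed
  have code_close: "\<bar>g y - (\<tau> * real (code y) + (- \<tau> - C))\<bar> \<le> \<tau>" if "y \<in> X" for y
  proof -
    let ?q = "(g y + C) / \<tau>"
    have "0 \<le> ?q" using C(2)[OF that] \<tau> by (intro divide_nonneg_nonneg) auto
    then have "real (code y) = of_int \<lfloor>?q\<rfloor> + 1" by (simp add: code_def)
    then have "\<tau> * (real (code y) - 1) \<le> \<tau> * ?q" "\<tau> * ?q \<le> \<tau> * real (code y)"
      using \<tau> by (simp_all only: mult_le_cancel_left_pos real_of_int_floor_add_one_ge add_diff_cancel_right' of_int_floor_le)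
    moreover have "\<tau> * ?q = g y + C" using \<tau> by simp
    ultimately show ?thesis unfolding right_diff_distrib by linarith
  qed
  have b_code: "\<exists>z\<in>X. b n = code z" for n
    unfolding b_def W.merge_def s_def using B.pseudo_orbit_in[OF x] by blast
  have b_top: "b \<in> topspace (full_shift k)"
    unfolding topspace_full_shift using b_code code_range by (intro CollectI allI) metis
  have toep: "toeplitz k b"
  proof (rule toeplitzI[OF b_top])
    fix n
    let ?q = "int (p (W.stage n))"
    have "0 < ?q" using W.p_pos by simp
    moreover have "\<forall>d. ?q dvd d \<longrightarrow> b (n + d) = b n"
      unfolding b_def using W.merge_periodic by blast
    ultimately show "\<exists>q::int. 0 < q \<and> (\<forall>d. q dvd d \<longrightarrow> b (n + d) = b n)" by blast
  qed
  have entropy: "seq_entropy k b = 0"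
  proof (rule seq_entropy_eq_0I[OF b_top])
    fix \<eta> :: real assume "0 < \<eta>"
    then obtain i where i: "1 / real (Suc i) < \<eta>"
      using reals_Archimedean[of \<eta>] by (auto simp: inverse_eq_divide)
    \<comment> \<open>\<open>V\<close> contains the blocks written by the stages from \<open>i\<close> on, \<open>V'\<close> the same blocks under the mask of the
      earlier stages.\<close>
    define V where "V = (\<lambda>z r. code (B.P i z r)) ` F i"
    define V' where "V' = (\<lambda>w r. if \<exists>t<i. int r \<in> W.window t then b (int r) else w r) ` V"
    have finF: "finite (F i)" using F(1)[of i] by (simp add: spanning_set_def)
    have "\<exists>w\<in>V. \<forall>r<l i. s t (l i * m + r) = w r" if "i \<le> t" for t m
      using B.pseudo_orbit_block[of i "Suc t" x m] that x unfolding V_def s_def by auto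
    then have "\<exists>w\<in>V'. \<forall>r<l i. b (int (l i) * m + int r) = w r" for m
      unfolding V'_def b_def by (intro W.merge_block)
    moreover have "card V' \<le> card (F i)"
      unfolding V'_def V_def using finF by (meson card_image_le finite_imageI order_trans)
    moreover have "exp (1 / real (Suc i) * real (l i)) \<le> exp (\<eta> * real (l i))"
      unfolding exp_le_cancel_iff by (rule mult_right_mono[OF less_imp_le[OF i]]) simp
    then have "real (card V') \<le> exp (\<eta> * real (l i))"
      using F(2)[of i] \<open>card V' \<le> card (F i)\<close> by linarith
    moreover have "finite V'" unfolding V'_def V_def using finF by simp
    ultimately show "\<exists>l>0. \<exists>W. finite W \<and> real (card W) \<le> exp (\<eta> * real l) \<and>
        (\<forall>m. \<exists>w\<in>W. \<forall>r<l. b (int l * m + int r) = w r)"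
      using l_pos[of i] by blast
  qed
  have close: "(\<Sum>n=1..M j. \<bar>g ((T ^^ n) x) - (\<tau> * real (b (int n)) + (- \<tau> - C))\<bar>) \<le> \<delta> * real (M j)" for j
  proof -
    define D where "D = {n. n < N j \<and> (\<exists>i<j. int n \<in> W.window i)}"
    have "real (card D) \<le> \<theta> * real (N j)"
      unfolding D_def
    proof (rule W.card_overridden_le)
      fix i
      have "1 * (2 ^ (i + 2) * real (N i)) \<le> \<theta> * real K * (2 ^ (i + 2) * real (N i))"
        using K\<theta> by (intro mult_right_mono) auto
      then show "2 ^ (i + 2) * real (N i) \<le> \<theta> * real (p i)" by (simp add: p_def mult_ac)
    qed
    also have "\<dots> \<le> \<theta> * real (2 * M j)" using \<theta> N_le[of j] by (intro mult_left_mono) auto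
    finally have card_D: "real (card D) \<le> 2 * \<theta> * real (M j)" by simp
    have "\<bar>g ((T ^^ n) x) - (\<tau> * real (b (int n)) + (- \<tau> - C))\<bar> \<le> 2 * \<tau> + (if n \<in> D then 2 * C + \<tau> else 0)"
      if n: "n \<in> {1..M j}" for n
    proof (cases "n \<in> D")
      case True
      obtain z where z: "z \<in> X" "b (int n) = code z" using b_code by blast
      then show ?thesis
        using True C(2)[OF B.iter_in[OF x], of n] C(2)[OF z(1)] code_close[OF z(1)] \<tau> by simp
    next
      case False
      let ?z = "B.P (Suc j) x n"
      have "n < N j" using n M_lt_N[of j] by simp
      then have "b (int n) = code ?z"
        using False W.merge_eq_stage[of n j s] by (auto simp: D_def b_def s_def)
      moreover have "dist ?z ((T ^^ n) x) < e"
        using B.pseudo_orbit_shadows[OF x, of "Suc j" n] sum_\<epsilon>[of "Suc j"] by linarith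
      then have "\<bar>g ?z - g ((T ^^ n) x)\<bar> < \<tau>"
        using e(2) B.pseudo_orbit_in[OF x] B.iter_in[OF x] by blast
      ultimately show ?thesis
        using False code_close[OF B.pseudo_orbit_in[OF x], of "Suc j" n] by simp
    qed
    then have "(\<Sum>n=1..M j. \<bar>g ((T ^^ n) x) - (\<tau> * real (b (int n)) + (- \<tau> - C))\<bar>)
        \<le> (\<Sum>n=1..M j. 2 * \<tau> + (if n \<in> D then 2 * C + \<tau> else 0))"
      by (rule sum_mono)
    also have "\<dots> = 2 * \<tau> * real (M j) + (2 * C + \<tau>) * real (card ({1..M j} \<inter> D))"
      by (simp add: sum.distrib sum.If_cases Int_def)
    also have "\<dots> \<le> 2 * \<tau> * real (M j) + (2 * C + \<tau>) * (2 * \<theta> * real (M j))"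
    proof -
      have "card ({1..M j} \<inter> D) \<le> card D" by (intro card_mono) (auto simp: D_def)
      then show ?thesis using card_D C(1) \<tau> by (intro add_left_mono mult_left_mono) auto
    qed
    also have "\<dots> = \<delta> * real (M j)"
    proof -
      have "(2 * C + \<tau>) * (2 * \<theta>) = \<delta> / 2" using C(1) \<tau> by (simp add: \<theta>_def field_simps)
      then have "(2 * C + \<tau>) * (2 * \<theta> * real (M j)) = \<delta> / 2 * real (M j)"
        by (simp only: mult.assoc[symmetric])
      then show ?thesis by (simp only: \<tau>_def)
    qed
    finally show ?thesis .
  qed
  have "\<forall>n0. \<exists>M\<ge>n0. M \<in> S \<and>
      (\<Sum>n=1..M. \<bar>g ((T ^^ n) x) - (\<tau> * real (b (int n)) + (- \<tau> - C))\<bar>) \<le> \<delta> * real M"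
  proof
    fix n0 show "\<exists>M\<ge>n0. M \<in> S \<and>
        (\<Sum>n=1..M. \<bar>g ((T ^^ n) x) - (\<tau> * real (b (int n)) + (- \<tau> - C))\<bar>) \<le> \<delta> * real M"
      by (rule exI[of _ "M n0"]) (intro conjI M_ge M_S close)
  qed
  moreover have "2 \<le> k" by (simp add: k_def)
  ultimately show ?thesis using toep entropy by blast
qed

section \<open>Sarnak's conjecture from Toeplitz sequences\<close>

lemma abs_moebius_mu_le_1: "\<bar>real_of_int (moebius_mu n)\<bar> \<le> 1"
  by (simp add: moebius_mu_def power_abs)

lemma constant_sequence_toeplitz_zero_entropy:
  "toeplitz 2 (\<lambda>_. 1)" "seq_entropy 2 (\<lambda>_. 1) = 0"
proof -
  have top: "(\<lambda>_. 1) \<in> topspace (full_shift 2)" by (simp add: topspace_full_shift)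
  then show "toeplitz 2 (\<lambda>_. 1)" by (rule toeplitzI) (auto intro: exI[of _ 1])
  show "seq_entropy 2 (\<lambda>_. 1) = 0"
    by (rule seq_entropy_eq_0I[OF top], rule exI[of _ 1]) (auto intro!: exI[of _ "{\<lambda>_. 1}"])
qed

text \<open>If the averages were at least \<open>\<delta>\<close> at infinitely many times, these times would serve as \<open>S\<close> in the
  approximation. An affine image of a Toeplitz sequence would then inherit averages of size \<open>\<delta> / 2\<close>. The
  linear part is excluded by the hypothesis for this sequence, the constant part by the hypothesis for the
  constant sequence.\<close>

lemma moebius_orthogonal_real:
  fixes X :: "'a::metric_space set" and g :: "'a \<Rightarrow> real"
  assumes toeplitz_disjoint:
      "\<forall>k\<ge>2. \<forall>b :: int \<Rightarrow> nat. toeplitz k b \<and> seq_entropy k b = 0 \<longrightarrow>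
         (\<lambda>N. (1 / real N) * (\<Sum>n=1..N. real_of_int (moebius_mu n) * real (b (int n)))) \<longlonglongrightarrow> 0"
    and sys: "top_dyn_system X T" and ent: "topological_entropy X T = 0"
    and g: "continuous_on X g" and x: "x \<in> X"
  shows "(\<lambda>N. (1 / real N) * (\<Sum>n=1..N. real_of_int (moebius_mu n) * g ((T ^^ n) x))) \<longlonglongrightarrow> 0"
proof (rule ccontr)
  define A where "A h N = (1 / real N) * (\<Sum>n=1..N. real_of_int (moebius_mu n) * h n)"
    for h :: "nat \<Rightarrow> real" and N
  let ?g = "\<lambda>n. g ((T ^^ n) x)"
  assume "\<not> (\<lambda>N. (1 / real N) * (\<Sum>n=1..N. real_of_int (moebius_mu n) * g ((T ^^ n) x))) \<longlonglongrightarrow> 0"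
  then have "\<not> A ?g \<longlonglongrightarrow> 0" by (simp add: A_def [abs_def])
  then obtain \<delta> where \<delta>: "0 < \<delta>" "\<And>n. \<exists>M\<ge>n. \<not> \<bar>A ?g M\<bar> < \<delta>"
    unfolding lim_sequentially dist_real_def by auto
  define S where "S = {M. \<delta> \<le> \<bar>A ?g M\<bar>}"
  have S: "\<exists>M\<ge>n. M \<in> S" for n using \<delta>(2)[of n] by (auto simp: S_def not_less)
  obtain k b \<alpha> \<beta> where k: "2 \<le> k" and b: "toeplitz k b" "seq_entropy k b = 0"
    and approx: "\<And>n0. \<exists>M\<ge>n0. M \<in> S \<and>
      (\<Sum>n=1..M. \<bar>?g n - (\<alpha> * real (b (int n)) + \<beta>)\<bar>) \<le> \<delta> / 2 * real M"
    using toeplitz_approximation[OF sys ent g x S half_gt_zero[OF \<delta>(1)]] by blast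
  let ?b = "\<lambda>n. real (b (int n))"
  have "A ?b \<longlonglongrightarrow> 0" using toeplitz_disjoint k b by (simp add: A_def [abs_def])
  moreover have "A (\<lambda>_. 1) \<longlonglongrightarrow> 0"
    using toeplitz_disjoint[rule_format, of 2 "\<lambda>_. 1"] constant_sequence_toeplitz_zero_entropy
    by (simp add: A_def [abs_def])
  ultimately have "(\<lambda>N. \<alpha> * A ?b N + \<beta> * A (\<lambda>_. 1) N) \<longlonglongrightarrow> \<alpha> * 0 + \<beta> * 0"
    by (intro tendsto_intros)
  then have "(\<lambda>N. \<bar>\<alpha> * A ?b N + \<beta> * A (\<lambda>_. 1) N\<bar>) \<longlonglongrightarrow> 0"
    using tendsto_rabs_zero by simp
  then have "\<forall>\<^sub>F N in sequentially. \<bar>\<alpha> * A ?b N + \<beta> * A (\<lambda>_. 1) N\<bar> < \<delta> / 2"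
    using half_gt_zero[OF \<delta>(1)] by (rule order_tendstoD(2))
  then obtain n0 where n0: "\<And>N. n0 \<le> N \<Longrightarrow> \<bar>\<alpha> * A ?b N + \<beta> * A (\<lambda>_. 1) N\<bar> < \<delta> / 2"
    unfolding eventually_sequentially by blast
  obtain M where M: "Suc n0 \<le> M" "M \<in> S"
      "(\<Sum>n=1..M. \<bar>?g n - (\<alpha> * ?b n + \<beta>)\<bar>) \<le> \<delta> / 2 * real M"
    using approx by blast
  have "A ?g M - (\<alpha> * A ?b M + \<beta> * A (\<lambda>_. 1) M) = A (\<lambda>n. ?g n - (\<alpha> * ?b n + \<beta>)) M"
    by (simp add: A_def sum_subtractf sum.distrib sum_distrib_left algebra_simps)
  also have "\<bar>\<dots>\<bar> \<le> \<delta> / 2"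
  proof -
    have "\<bar>\<Sum>n=1..M. real_of_int (moebius_mu n) * (?g n - (\<alpha> * ?b n + \<beta>))\<bar> \<le>
        (\<Sum>n=1..M. 1 * \<bar>?g n - (\<alpha> * ?b n + \<beta>)\<bar>)"
      by (rule order_trans[OF sum_abs], rule sum_mono, subst abs_mult)
        (intro mult_right_mono abs_moebius_mu_le_1 abs_ge_zero)
    also have "\<dots> \<le> \<delta> / 2 * real M" using M(3) by simp
    finally show ?thesis using M(1) by (simp add: A_def abs_mult divide_le_eq)
  qed
  finally have "\<bar>A ?g M\<bar> < \<delta>" using n0[of M] M(1) by linarith
  then show False using M(2) by (simp add: S_def)
qed

theorem corollary1p2:
  fixes X :: "'a::metric_space set" and T :: "'a \<Rightarrow> 'a" and f :: "'a \<Rightarrow> complex" and x :: 'a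
  assumes toeplitz_disjoint:
      "\<forall>k\<ge>2. \<forall>b :: int \<Rightarrow> nat. toeplitz k b \<and> seq_entropy k b = 0 \<longrightarrow>
         (\<lambda>N. (1 / real N) * (\<Sum>n=1..N. real_of_int (moebius_mu n) * real (b (int n)))) \<longlonglongrightarrow> 0"
    and "top_dyn_system X T"
    and "topological_entropy X T = 0"
    and "continuous_on X f"
    and "x \<in> X"
  shows "(\<lambda>N. (1 / of_nat N) * (\<Sum>n=1..N. of_int (moebius_mu n) * f ((T ^^ n) x))) \<longlonglongrightarrow> 0"
proof -
  let ?A = "\<lambda>N. (1 / of_nat N) * (\<Sum>n=1..N. of_int (moebius_mu n) * f ((T ^^ n) x))"
  have A: "?A N = of_real (1 / real N) * (\<Sum>n=1..N. of_real (real_of_int (moebius_mu n)) * f ((T ^^ n) x))" for N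
    by simp
  have "(\<lambda>N. (1 / real N) * (\<Sum>n=1..N. real_of_int (moebius_mu n) * Re (f ((T ^^ n) x)))) \<longlonglongrightarrow> 0"
    using assms by (intro moebius_orthogonal_real[where X = X]) (auto intro: continuous_on_Re)
  moreover have "(\<lambda>N. (1 / real N) * (\<Sum>n=1..N. real_of_int (moebius_mu n) * Im (f ((T ^^ n) x)))) \<longlonglongrightarrow> 0"
    using assms by (intro moebius_orthogonal_real[where X = X]) (auto intro: continuous_on_Im)
  ultimately show ?thesis
    unfolding tendsto_complex_iff A
    by (simp only: times_complex.sel Re_sum Im_sum Re_complex_of_real Im_complex_of_real
        mult_zero_left diff_zero add_0_right zero_complex.sel)
qed

end
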